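(* Let $f:\operatorname{dom}(f)\subseteq\mathbb{R}^n\to\mathbb{R}$ be $\mathcal{C}^3$ on the open ball $B(x^0,\overline{\Delta})$, and denote by $L$ the Lipschitz constant of $\nabla^2 f$ on this ball. Let $\mathcal{X}=\langle x^0,x^1,\ldots,x^m\rangle$ be an ordered set of distinct points in $\mathbb{R}^n$ with radius $\Delta<\overline{\Delta}$, and suppose that $\operatorname{rank} S=n$, where $S=S(\mathcal{X})$. Then $$\|\nabla^c f(\mathcal{X})-\nabla f(x^0)\|\le \frac{L\sqrt{m}}{6}\left\|(\widehat{S}^\top)^\dagger\right\|\Delta^2,$$ where $\widehat{S}=S/\Delta$.
   Context: Vectors carry the Euclidean norm and matrices the induced operator norm. $A^\dagger$ denotes the Moore--Penrose pseudoinverse of a matrix $A$. For an ordered set of points $\mathcal{X}=\langle x^0,x^1,\ldots,x^m\rangle$ write $x^i=x^0+d^i$, $i=1,\ldots,m$ ($m\ge 1$). Its radius is $\Delta=\max_{1\le i\le m}\|d^i\|$, and $S(\mathcal{X})=[d^1\ \cdots\ d^m]\in\mathbb{R}^{n\times m}$. The generalized centred simplex gradient of $f$ over $\mathcal{X}$ is $\nabla^c f(\mathcal{X})=(S(\mathcal{X})^\top)^\dagger\,\delta^c_f(\mathcal{X})\in\mathbb{R}^n$, where $\delta^c_f(\mathcal{X})\in\mathbb{R}^m$ has $i$-th entry $\tfrac12\big(f(x^0+d^i)-f(x^0-d^i)\big)$. "$L$ is the Lipschitz constant of $\nabla^2 f$" means $\|\nabla^2 f(x)-\nabla^2 f(y)\|\le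 L\|x-y\|$ for all $x,y\in B(x^0,\overline{\Delta})$ (such a finite $L$ is assumed to exist). *)

theory Defs
  imports "HOL-Analysis.Analysis"
begin

(* The norm of the type real^'m^'n is the Frobenius norm; this is the operator
   norm induced by the Euclidean norms on real^'m and real^'n. *)
definition op_norm :: "real^'m^'n \<Rightarrow> real" where
  "op_norm A = onorm (\<lambda>v. A *v v)"

(* The four Penrose conditions; every real matrix A has exactly one such X. *)
definition is_pseudoinverse :: "real^'m^'n \<Rightarrow> real^'n^'m \<Rightarrow> bool" where
  "is_pseudoinverse A X \<longleftrightarrow>
     A ** X ** A = A \<and> X ** A ** X = X \<and>
     transpose (A ** X) = A ** X \<and> transpose (X ** A) = X ** A"

definition pseudoinverse :: "real^'m^'n \<Rightarrow> real^'n^'m" where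
  "pseudoinverse A = (THE X. is_pseudoinverse A X)"

(* Intended for open S: f is k times continuously differentiable on S.
   Continuity of all directional derivatives x \<mapsto> Df(x) v is equivalent, in finite
   dimension, to continuity of the derivative x \<mapsto> Df(x). *)
primrec C_k_on :: "nat \<Rightarrow> ('a::euclidean_space \<Rightarrow> real) \<Rightarrow> 'a set \<Rightarrow> bool" where
  "C_k_on 0 f S \<longleftrightarrow> continuous_on S f"
| "C_k_on (Suc k) f S \<longleftrightarrow>
     (\<forall>x\<in>S. f differentiable (at x)) \<and>
     (\<forall>v. C_k_on k (\<lambda>x. frechet_derivative f (at x) v) S)"

definition grad :: "(real^'n \<Rightarrow> real) \<Rightarrow> real^'n \<Rightarrow> real^'n" where
  "grad f x = (THE D. GDERIV f x :> D)"

definition hessian :: "(real^'n \<Rightarrow> real) \<Rightarrow> real^'n \<Rightarrow> real^'n^'n" where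
  "hessian f x = jacobian (grad f) (at x)"

(* The ordered set of points x^0, x^1, ..., x^m is given by the reference point x0 and
   the family x of the other points, indexed by a finite type 'm with m = CARD('m). *)

definition sample_radius :: "real^'n \<Rightarrow> ('m::finite \<Rightarrow> real^'n) \<Rightarrow> real" where
  "sample_radius x0 x = Max (range (\<lambda>i. norm (x i - x0)))"

definition simplex_matrix :: "real^'n \<Rightarrow> ('m::finite \<Rightarrow> real^'n) \<Rightarrow> real^'m^'n" where
  "simplex_matrix x0 x = (\<chi> j i. (x i - x0) $ j)"

definition delta_c :: "(real^'n \<Rightarrow> real) \<Rightarrow> real^'n \<Rightarrow> ('m::finite \<Rightarrow> real^'n) \<Rightarrow> real^'m" where
  "delta_c f x0 x = (\<chi> i. (f (x0 + (x i - x0)) - f (x0 - (x i - x0))) / 2)"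

definition centred_simplex_gradient ::
    "(real^'n \<Rightarrow> real) \<Rightarrow> real^'n \<Rightarrow> ('m::finite \<Rightarrow> real^'n) \<Rightarrow> real^'n" where
  "centred_simplex_gradient f x0 x =
     pseudoinverse (transpose (simplex_matrix x0 x)) *v delta_c f x0 x"

end

theory Submission
  imports Defs
begin

text \<open>
  Put \<open>A = S\<^sup>T\<close>, a matrix whose rows are the displacements \<open>d\<^sub>i = x\<^sub>i - x\<^sub>0\<close>. Full rank of \<open>S\<close> makes
  \<open>A\<close> injective, so its pseudoinverse \<open>P\<close> is a left inverse and, with \<open>g\<close> the gradient at
  \<open>x\<^sub>0\<close> and \<open>\<delta>\<close> the vector of centred differences, the error of the simplex gradient is
  \<open>P \<delta> - g = P (\<delta> - A g)\<close>. Since the pseudoinverse of \<open>A / \<Delta>\<close> is \<open>\<Delta> P\<close>, it remains to bound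
  each of the \<open>m\<close> entries of \<open>\<delta> - A g\<close> by \<open>L \<Delta>\<^sup>3 / 6\<close>; the Euclidean norm then contributes the
  factor \<open>\<surd>m\<close>.

  The entry for a displacement \<open>d\<close> is the value at \<open>t = 1\<close> of
  \<open>\<psi> t = (f (x\<^sub>0 + t d) - f (x\<^sub>0 - t d)) / 2 - t (g \<bullet> d)\<close>. Forming the odd part cancels the
  second-order term: \<open>\<psi>\<close> and \<open>\<psi>'\<close> vanish at \<open>0\<close>, and \<open>\<psi>'' t\<close> is half the difference of the
  Hessian form \<open>d \<bullet> H d\<close> at two points at distance \<open>2 t \<parallel>d\<parallel>\<close>, hence at most
  \<open>L \<parallel>d\<parallel>\<^sup>3 t\<close> in absolute value. Integrating twice gives \<open>L \<parallel>d\<parallel>\<^sup>3 / 6\<close>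
  (\<open>centred_difference_error\<close>).
\<close>

section \<open>Pseudoinverses of injective matrices\<close>

text \<open>Both \<open>A X\<close> and \<open>A Y\<close> are the orthogonal projection onto the range of \<open>A\<close>, so they agree;
  likewise \<open>X A = Y A\<close>, the projection onto the orthogonal complement of the kernel. Then \<open>X = X A X = X A Y = Y A Y = Y\<close>.\<close>

lemma is_pseudoinverse_unique:
  fixes A :: "real^'m^'n"
  assumes X: "is_pseudoinverse A X" and Y: "is_pseudoinverse A Y"
  shows "X = Y"
proof -
  have x: "A ** X ** A = A" "X ** A ** X = X"
      "transpose (A ** X) = A ** X" "transpose (X ** A) = X ** A"
    and y: "A ** Y ** A = A" "Y ** A ** Y = Y"
      "transpose (A ** Y) = A ** Y" "transpose (Y ** A) = Y ** A"
    using X Y by (auto simp: is_pseudoinverse_def)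
  have "A ** X = (A ** Y) ** (A ** X)"
    by (simp add: matrix_mul_assoc y(1))
  also have "\<dots> = transpose ((A ** X) ** (A ** Y))"
    by (metis matrix_transpose_mul x(3) y(3))
  also have "\<dots> = A ** Y"
    by (simp add: matrix_mul_assoc x(1) y(3))
  finally have AX: "A ** X = A ** Y" .
  have "X ** A = (X ** A) ** (Y ** A)"
    by (metis matrix_mul_assoc y(1))
  also have "\<dots> = transpose ((Y ** A) ** (X ** A))"
    by (metis matrix_transpose_mul x(4) y(4))
  also have "\<dots> = Y ** A"
    by (metis matrix_mul_assoc x(1) y(4))
  finally have XA: "X ** A = Y ** A" .
  show ?thesis
    by (metis AX XA matrix_mul_assoc x(2) y(2))
qed

lemma pseudoinverse_eqI: "is_pseudoinverse A X \<Longrightarrow> pseudoinverse A = X"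
  unfolding pseudoinverse_def by (blast intro: is_pseudoinverse_unique the_equality)

text \<open>For injective \<open>A\<close> the Gram matrix \<open>A\<^sup>T A\<close> is invertible, because \<open>A\<^sup>T A v = 0\<close> forces
  \<open>\<parallel>A v\<parallel>\<^sup>2 = v \<bullet> A\<^sup>T A v = 0\<close>. The pseudoinverse is then \<open>(A\<^sup>T A)\<^sup>-\<^sup>1 A\<^sup>T\<close>.\<close>

lemma pseudoinverse_of_injective:
  fixes A :: "real^'n^'m"
  assumes inj: "inj ((*v) A)"
  shows "is_pseudoinverse A (pseudoinverse A)" and "pseudoinverse A ** A = mat 1"
proof -
  define G where "G = transpose A ** A"
  have "inj ((*v) G)"
  proof (rule injI)
    fix u v assume "G *v u = G *v v"
    then have "transpose A *v (A *v (u - v)) = 0"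
      by (simp add: G_def matrix_vector_mul_assoc matrix_vector_mult_diff_distrib)
    then have "(A *v (u - v)) \<bullet> (A *v (u - v)) = 0"
      by (metis dot_lmul_matrix inner_zero_right matrix_vector_mul_assoc 
          transpose_matrix_vector inner_commute inner_zero_left)
    then have "A *v u = A *v v"
      by (simp add: matrix_vector_mult_diff_distrib)
    then show "u = v" using inj by (simp add: inj_eq)
  qed
  then obtain B where BG: "B ** G = mat 1"
    by (metis matrix_left_invertible_injective)
  then have GB: "G ** B = mat 1"
    by (simp add: matrix_left_right_inverse)
  have "transpose G = G"
    by (simp add: G_def matrix_transpose_mul)
  then have "transpose B ** G = mat 1"
    by (metis GB matrix_transpose_mul transpose_mat)
  then have symB: "transpose B = B"
    by (metis GB matrix_mul_assoc matrix_mul_lid matrix_mul_rid)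
  have XA: "(B ** transpose A) ** A = mat 1"
    using BG by (simp add: G_def matrix_mul_assoc)
  have "is_pseudoinverse A (B ** transpose A)"
    unfolding is_pseudoinverse_def
  proof (intro conjI)
    show "A ** (B ** transpose A) ** A = A"
      by (metis XA matrix_mul_assoc matrix_mul_rid)
    show "transpose (A ** (B ** transpose A)) = A ** (B ** transpose A)"
      by (simp add: matrix_transpose_mul symB matrix_mul_assoc)
  qed (simp_all add: XA transpose_mat)
  then show "is_pseudoinverse A (pseudoinverse A)" "pseudoinverse A ** A = mat 1"
    using XA by (simp_all add: pseudoinverse_eqI)
qed

lemma pseudoinverse_scaleR:
  fixes A :: "real^'m^'n"
  assumes "is_pseudoinverse A X" "c \<noteq> 0"
  shows "pseudoinverse (c *\<^sub>R A) = X /\<^sub>R c"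
  using assms
  by (intro pseudoinverse_eqI)
     (simp add: is_pseudoinverse_def transpose_scalar
        matrix_scalar_ac scalar_matrix_assoc[symmetric])

section \<open>The operator norm\<close>

lemma norm_matrix_vector_le_op_norm:
  fixes A :: "real^'m^'n"
  shows "norm (A *v v) \<le> op_norm A * norm v"
  unfolding op_norm_def by (rule onorm) simp

lemma op_norm_nonneg:
  fixes A :: "real^'m^'n"
  shows "0 \<le> op_norm A"
  unfolding op_norm_def by (rule onorm_pos_le) simp

lemma op_norm_scaleR:
  fixes A :: "real^'m^'n"
  shows "op_norm (c *\<^sub>R A) = \<bar>c\<bar> * op_norm A"
  unfolding op_norm_def scaleR_matrix_vector_assoc[symmetric]
  by (rule onorm_scaleR) simp

section \<open>Gradient and Hessian of a twice differentiable function\<close>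

lemma grad_inner_eq_frechet_derivative:
  fixes f :: "real^'n \<Rightarrow> real"
  assumes "f differentiable (at y)"
  shows "(f has_derivative (\<lambda>v. grad f y \<bullet> v)) (at y)"
    and "grad f y \<bullet> v = frechet_derivative f (at y) v"
proof -
  let ?F = "frechet_derivative f (at y)"
  have F: "(f has_derivative ?F) (at y)"
    using assms by (simp add: frechet_derivative_works)
  then have lin: "linear ?F" by (rule has_derivative_linear)
  define D where "D = (\<Sum>b\<in>Basis. ?F b *\<^sub>R b)"
  have FD: "?F = (\<lambda>v. v \<bullet> D)"
  proof
    fix v
    have "?F v = ?F (\<Sum>b\<in>Basis. (v \<bullet> b) *\<^sub>R b)" by (simp add: euclidean_representation)
    also have "\<dots> = (\<Sum>b\<in>Basis. (v \<bullet> b) * ?F b)"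
      using lin by (simp add: linear_sum linear_scale)
    finally show "?F v = v \<bullet> D" by (simp add: D_def inner_sum_right mult.commute)
  qed
  have gd: "GDERIV f y :> D" using F unfolding gderiv_def FD by simp
  have "D' = D" if "GDERIV f y :> D'" for D'
    using has_derivative_unique[OF that[unfolded gderiv_def] gd[unfolded gderiv_def]]
    by (metis vector_eq_ldot inner_commute)
  with gd have "grad f y = D" unfolding grad_def by (blast intro: the_equality)
  with F FD show "(f has_derivative (\<lambda>v. grad f y \<bullet> v)) (at y)"
    and "grad f y \<bullet> v = ?F v" by (simp_all add: inner_commute)
qed

text \<open>The gradient inherits differentiability from the directional derivatives
  \<open>y \<mapsto> D f(y) v\<close>, which are its components when \<open>v\<close> runs through the basis. Openness
  of \<open>U\<close> is what lets the two be compared near a point.\<close>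

lemma has_derivative_grad_hessian:
  fixes f :: "real^'n \<Rightarrow> real"
  assumes C2: "C_k_on (Suc (Suc k)) f U" and "open U" "y \<in> U"
  shows "(grad f has_derivative (\<lambda>v. hessian f y *v v)) (at y)"
proof -
  have diff: "(\<lambda>z. grad f z \<bullet> b) differentiable (at y)" for b
  proof -
    have "(\<lambda>z. frechet_derivative f (at z) b) differentiable (at y)"
      using C2 \<open>y \<in> U\<close> by simp
    then obtain D where "((\<lambda>z. frechet_derivative f (at z) b) has_derivative D) (at y)"
      unfolding differentiable_def by blast
    then have "((\<lambda>z. grad f z \<bullet> b) has_derivative D) (at y)"
      using C2 by (rule_tac has_derivative_transform_within_open[OF _ \<open>open U\<close> \<open>y \<in> U\<close>])
        (simp_all add: grad_inner_eq_frechet_derivative)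
    then show ?thesis unfolding differentiable_def by blast
  qed
  then have "grad f differentiable (at y)"
    using differentiable_componentwise_within[of "grad f" y UNIV] by simp
  then show ?thesis
    unfolding hessian_def by (rule jacobian_works[THEN iffD1])
qed

section \<open>The centred difference\<close>

text \<open>Comparing \<open>h\<close> with \<open>K t\<^sup>3 / 6\<close>, whose second derivative is \<open>K t\<close>, two successive
  monotonicity arguments give a one-sided estimate.\<close>

lemma le_cubic_of_second_derivative_le:
  fixes h h' h'' :: "real \<Rightarrow> real"
  assumes h: "\<And>t. 0 \<le> t \<Longrightarrow> t \<le> 1 \<Longrightarrow> (h has_real_derivative h' t) (at t)"
    and h': "\<And>t. 0 \<le> t \<Longrightarrow> t \<le> 1 \<Longrightarrow> (h' has_real_derivative h'' t) (at t)"
    and zero: "h 0 = 0" "h' 0 = 0"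
    and bound: "\<And>t. 0 \<le> t \<Longrightarrow> t \<le> 1 \<Longrightarrow> h'' t \<le> K * t"
  shows "h 1 \<le> K / 6"
proof -
  have h'_le: "h' t \<le> K * t\<^sup>2 / 2" if t: "0 \<le> t" "t \<le> 1" for t
  proof -
    have "(\<lambda>s. K * s\<^sup>2 / 2 - h' s) 0 \<le> (\<lambda>s. K * s\<^sup>2 / 2 - h' s) t"
    proof (rule DERIV_nonneg_imp_nondecreasing[OF t(1)])
      fix s assume s: "0 \<le> s" "s \<le> t"
      show "\<exists>y. ((\<lambda>s. K * s\<^sup>2 / 2 - h' s) has_real_derivative y) (at s) \<and> 0 \<le> y"
        using s t bound[of s]
        by (intro exI[of _ "K * s - h'' s"]) (auto intro!: derivative_eq_intros h')
    qed
    then show ?thesis using zero by simp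
  qed
  have "(\<lambda>s. K * s ^ 3 / 6 - h s) 0 \<le> (\<lambda>s. K * s ^ 3 / 6 - h s) 1"
  proof (rule DERIV_nonneg_imp_nondecreasing[OF zero_le_one])
    fix s :: real assume s: "0 \<le> s" "s \<le> 1"
    show "\<exists>y. ((\<lambda>s. K * s ^ 3 / 6 - h s) has_real_derivative y) (at s) \<and> 0 \<le> y"
      using s h'_le[of s]
      by (intro exI[of _ "K * s\<^sup>2 / 2 - h' s"]) (auto intro!: derivative_eq_intros h)
  qed
  then show ?thesis using zero by simp
qed

text \<open>With \<open>\<psi>\<close> the odd part of \<open>f\<close> along \<open>d\<close> minus its linear term, the even-order terms of
  the Taylor expansion cancel. Only differences of Hessian values enter \<open>\<psi>''\<close>, so a Lipschitz
  bound on the Hessian replaces a bound on third derivatives.\<close>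

lemma centred_difference_error:
  fixes f :: "real^'n \<Rightarrow> real"
  assumes C2: "C_k_on (Suc (Suc k)) f (ball x0 r)"
    and Lip: "\<And>y z. y \<in> ball x0 r \<Longrightarrow> z \<in> ball x0 r \<Longrightarrow>
                op_norm (hessian f y - hessian f z) \<le> L * norm (y - z)"
    and d: "norm d < r"
  shows "\<bar>(f (x0 + d) - f (x0 - d)) / 2 - grad f x0 \<bullet> d\<bar> \<le> L * norm d ^ 3 / 6"
proof -
  define \<psi> where "\<psi> t = (f (x0 + t *\<^sub>R d) - f (x0 - t *\<^sub>R d)) / 2 - t * (grad f x0 \<bullet> d)" for t
  define \<psi>' where "\<psi>' t = (grad f (x0 + t *\<^sub>R d) \<bullet> d + grad f (x0 - t *\<^sub>R d) \<bullet> d) / 2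
      - grad f x0 \<bullet> d" for t
  define \<psi>'' where "\<psi>'' t = ((hessian f (x0 + t *\<^sub>R d) *v d) \<bullet> d
      - (hessian f (x0 - t *\<^sub>R d) *v d) \<bullet> d) / 2" for t
  have in_ball: "x0 + t *\<^sub>R d \<in> ball x0 r" "x0 - t *\<^sub>R d \<in> ball x0 r" if "0 \<le> t" "t \<le> 1" for t
  proof -
    have "norm (t *\<^sub>R d) \<le> norm d" using that by (simp add: mult_left_le_one_le)
    with d show "x0 + t *\<^sub>R d \<in> ball x0 r" "x0 - t *\<^sub>R d \<in> ball x0 r"
      by (simp_all add: dist_norm)
  qed
  have line: "((\<lambda>s. x0 + s *\<^sub>R e) has_derivative (\<lambda>s. s *\<^sub>R e)) (at t)" for e t
    by (auto intro!: derivative_eq_intros)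
  have f_line: "((\<lambda>s. f (x0 + s *\<^sub>R e)) has_real_derivative grad f (x0 + t *\<^sub>R e) \<bullet> e) (at t)"
    if "x0 + t *\<^sub>R e \<in> ball x0 r" for e t
  proof -
    have "(f has_derivative (\<lambda>v. grad f (x0 + t *\<^sub>R e) \<bullet> v)) (at (x0 + t *\<^sub>R e))"
      using C2 that by (intro grad_inner_eq_frechet_derivative(1)) simp
    from has_derivative_compose[OF line this] show ?thesis
      by (simp add: has_field_derivative_def mult.commute[of _ "_ \<bullet> _"])
  qed
  have grad_line: "((\<lambda>s. grad f (x0 + s *\<^sub>R e) \<bullet> d) has_real_derivative
      (hessian f (x0 + t *\<^sub>R e) *v e) \<bullet> d) (at t)"
    if "x0 + t *\<^sub>R e \<in> ball x0 r" for e t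
    using has_derivative_inner_left[OF has_derivative_compose[OF line
          has_derivative_grad_hessian[OF C2 open_ball that]], of d]
    by (simp add: has_field_derivative_def matrix_vector_mult_scaleR mult.commute[of _ "_ \<bullet> _"])
  have \<psi>: "(\<psi> has_real_derivative \<psi>' t) (at t)" if "0 \<le> t" "t \<le> 1" for t
    using f_line[of t d] f_line[of t "- d"] in_ball[OF that]
    unfolding \<psi>_def \<psi>'_def by (auto intro!: derivative_eq_intros)
  have \<psi>': "(\<psi>' has_real_derivative \<psi>'' t) (at t)" if "0 \<le> t" "t \<le> 1" for t
    using grad_line[of t d] grad_line[of t "- d"] in_ball[OF that]
    unfolding \<psi>'_def \<psi>''_def
    by (auto intro!: derivative_eq_intros simp: vec.neg)
  have bound: "\<bar>\<psi>'' t\<bar> \<le> L * norm d ^ 3 * t" if t: "0 \<le> t" "t \<le> 1" for t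
  proof -
    define M where "M = hessian f (x0 + t *\<^sub>R d) - hessian f (x0 - t *\<^sub>R d)"
    have "(x0 + t *\<^sub>R d) - (x0 - t *\<^sub>R d) = (2 * t) *\<^sub>R d"
      by (simp add: algebra_simps flip: scaleR_2)
    then have "norm ((x0 + t *\<^sub>R d) - (x0 - t *\<^sub>R d)) = 2 * t * norm d"
      using t by simp
    then have M: "op_norm M \<le> L * (2 * t * norm d)"
      using Lip[OF in_ball[OF t]] by (simp add: M_def)
    have "\<bar>(M *v d) \<bullet> d\<bar> \<le> norm (M *v d) * norm d"
      by (rule Cauchy_Schwarz_ineq2)
    also have "\<dots> \<le> (op_norm M * norm d) * norm d"
      by (intro mult_right_mono norm_matrix_vector_le_op_norm) simp
    also have "\<dots> \<le> (L * (2 * t * norm d) * norm d) * norm d"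
      by (intro mult_right_mono M) simp_all
    finally have "\<bar>(M *v d) \<bullet> d\<bar> \<le> 2 * (L * norm d ^ 3 * t)"
      by (simp add: power3_eq_cube mult_ac)
    moreover have "\<psi>'' t = ((M *v d) \<bullet> d) / 2"
      by (simp add: \<psi>''_def M_def matrix_vector_mult_diff_rdistrib inner_diff_left)
    ultimately show ?thesis by simp
  qed
  \<comment> \<open>The cubic estimate is one-sided, so it is applied to both \<open>\<psi>\<close> and \<open>-\<psi>\<close>.\<close>
  have "\<psi> 0 = 0" "\<psi>' 0 = 0" by (simp_all add: \<psi>_def \<psi>'_def)
  then have "\<psi> 1 \<le> L * norm d ^ 3 / 6" "- \<psi> 1 \<le> L * norm d ^ 3 / 6"
    using le_cubic_of_second_derivative_le[of \<psi> \<psi>' \<psi>'' "L * norm d ^ 3"]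
      le_cubic_of_second_derivative_le[of "\<lambda>t. - \<psi> t" "\<lambda>t. - \<psi>' t" "\<lambda>t. - \<psi>'' t"
        "L * norm d ^ 3"]
    using \<psi> \<psi>' bound by (auto simp: abs_le_iff intro!: DERIV_minus)
  then have "\<bar>\<psi> 1\<bar> \<le> L * norm d ^ 3 / 6" by linarith
  then show ?thesis by (simp add: \<psi>_def)
qed

section \<open>Error bound of the centred simplex gradient\<close>

lemma norm_le_sqrt_card_times_bound:
  fixes v :: "real^'m"
  assumes "\<And>i. \<bar>v $ i\<bar> \<le> e"
  shows "norm v \<le> sqrt (real CARD('m)) * e"
proof -
  have e: "0 \<le> e" using assms[of undefined] by simp
  have "norm v \<le> L2_set (\<lambda>_::'m. e) UNIV"
    unfolding norm_vec_def using assms by (intro L2_set_mono) simp_all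
  also have "\<dots> = sqrt (real CARD('m)) * e"
    using e by (simp add: L2_set_constant)
  finally show ?thesis .
qed

theorem theorem3p3:
  fixes f :: "real^'n \<Rightarrow> real"
    and x0 :: "real^'n"
    and x :: "'m::finite \<Rightarrow> real^'n"
    and L \<Delta> \<Delta>bar :: real
    and S Shat :: "real^'m^'n"
  assumes C3: "C_k_on 3 f (ball x0 \<Delta>bar)"
    and Lip: "\<forall>y\<in>ball x0 \<Delta>bar. \<forall>z\<in>ball x0 \<Delta>bar.
                op_norm (hessian f y - hessian f z) \<le> L * norm (y - z)"
    and distinct_points: "inj x" "x0 \<notin> range x"
    and radius: "\<Delta> = sample_radius x0 x" "\<Delta> < \<Delta>bar"
    and S: "S = simplex_matrix x0 x"
    and full_rank: "rank S = CARD('n)"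
    and Shat: "Shat = S /\<^sub>R \<Delta>"
  shows "norm (centred_simplex_gradient f x0 x - grad f x0)
           \<le> L * sqrt (real CARD('m)) / 6 * op_norm (pseudoinverse (transpose Shat)) * \<Delta>\<^sup>2"
proof -
  let ?A = "transpose S" and ?g = "grad f x0"
  define P where "P = pseudoinverse ?A"
  define d where "d i = x i - x0" for i
  have d_le: "norm (d i) \<le> \<Delta>" for i
    unfolding radius(1) sample_radius_def d_def by (rule Max_ge) auto
  have d_pos: "0 < norm (d i)" for i
    using distinct_points(2) by (auto simp: d_def)
  have \<Delta>_pos: "0 < \<Delta>"
    using d_pos d_le less_le_trans by blast
  \<comment> \<open>The ball contains two distinct points, so the Lipschitz condition forces \<open>L \<ge> 0\<close>; this is
    what allows each \<open>norm (d i)\<close> to be replaced by \<open>\<Delta>\<close>.\<close>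
  have L_nonneg: "0 \<le> L"
  proof -
    have "x0 + d undefined \<in> ball x0 \<Delta>bar" "x0 \<in> ball x0 \<Delta>bar"
      using d_le[of undefined] \<Delta>_pos radius(2) by (simp_all add: dist_norm)
    then have "op_norm (hessian f (x0 + d undefined) - hessian f x0)
        \<le> L * norm (x0 + d undefined - x0)"
      using Lip by blast
    then have "0 \<le> L * norm (d undefined)"
      using op_norm_nonneg[of "hessian f (x0 + d undefined) - hessian f x0"] by simp
    then show ?thesis using d_pos[of undefined] by (simp add: zero_le_mult_iff)
  qed
  have "inj ((*v) ?A)"
    using full_rank by (simp add: rank_transpose flip: full_rank_injective)
  then have P: "is_pseudoinverse ?A P" "P ** ?A = mat 1"
    unfolding P_def by (rule pseudoinverse_of_injective)+
  have Phat: "op_norm (pseudoinverse (transpose Shat)) = \<Delta> * op_norm P"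
  proof -
    have "transpose Shat = inverse \<Delta> *\<^sub>R ?A"
      by (simp add: Shat transpose_scalar)
    then show ?thesis
      using pseudoinverse_scaleR[OF P(1), of "inverse \<Delta>"] \<Delta>_pos by (simp add: op_norm_scaleR)
  qed
  \<comment> \<open>Since \<open>P\<close> is a left inverse of \<open>?A\<close>, \<open>?g = P (?A ?g)\<close>, and the error is the image of
    the residual \<open>w\<close> under \<open>P\<close>.\<close>
  define w where "w = delta_c f x0 x - ?A *v ?g"
  have "centred_simplex_gradient f x0 x - ?g = P *v w"
    using P(2) by (simp add: w_def P_def centred_simplex_gradient_def S
        matrix_vector_mult_diff_distrib matrix_vector_mul_assoc
        del: transpose_matrix_vector)
  then have "norm (centred_simplex_gradient f x0 x - ?g) \<le> op_norm P * norm w"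
    by (simp add: norm_matrix_vector_le_op_norm)
  also have "norm w \<le> sqrt (real CARD('m)) * (L * \<Delta> ^ 3 / 6)"
  proof (rule norm_le_sqrt_card_times_bound)
    fix i
    have "(?A *v ?g) $ i = ?g \<bullet> d i"
      by (simp add: S d_def simplex_matrix_def transpose_def matrix_vector_mult_def
          inner_vec_def mult.commute)
    then have "\<bar>w $ i\<bar> = \<bar>(f (x0 + d i) - f (x0 - d i)) / 2 - ?g \<bullet> d i\<bar>"
      by (simp add: w_def delta_c_def d_def)
    also have "\<dots> \<le> L * norm (d i) ^ 3 / 6"
    proof (rule centred_difference_error)
      show "C_k_on (Suc (Suc 1)) f (ball x0 \<Delta>bar)"
        using C3 by (simp add: numeral_3_eq_3)
      show "norm (d i) < \<Delta>bar" using d_le[of i] radius(2) by simp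
    qed (use Lip in blast)
    also have "\<dots> \<le> L * \<Delta> ^ 3 / 6"
      using L_nonneg d_le[of i] by (intro divide_right_mono mult_left_mono power_mono) auto
    finally show "\<bar>w $ i\<bar> \<le> L * \<Delta> ^ 3 / 6" .
  qed
  then have "op_norm P * norm w \<le> op_norm P * (sqrt (real CARD('m)) * (L * \<Delta> ^ 3 / 6))"
    by (intro mult_left_mono op_norm_nonneg)
  finally show ?thesis
    unfolding Phat by (simp add: power3_eq_cube power2_eq_square mult_ac)
qed

end
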